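(* Let $0\le\tau\le1$, $0<t_e<1$, $t_d=1-t_e$, and let $$\epsilon=t_e\left(\gamma_2Pr^{-\alpha}|h|^2+\tfrac32\gamma_4P^2r^{-2\alpha}|h|^4\right),\qquad \epsilon_o=\tau\epsilon,\qquad \epsilon_c=(1-\tau)\epsilon,$$ $$\ell_o=t_dB\log_2\left(1+\frac{\epsilon_o}{t_d}\frac{|g|^2}{r^{\alpha}\sigma^2}\right),\qquad \ell_c=\left(\frac{\epsilon_c}{\xi\psi^3}\right)^{1/3}.$$ Then the average number of offloaded and locally computed bits $\bar\ell(\tau,t_e)=\mathbb{E}[\ell_o+\ell_c]$ is $$\bar\ell(\tau,t_e)=\frac{t_dB}{\ln2}\int_0^\infty\exp\left(\frac{t_dr^{\alpha}\sigma^2}{\tau t_ex}\right)E_1\left(\frac{t_dr^{\alpha}\sigma^2}{\tau t_ex}\right)f_H(x)\,dx+\left(\frac{(1-\tau)t_e}{\xi\psi^3}\right)^{1/3}\int_0^\infty x^{1/3}f_H(x)\,dx,$$ where, for $x>0$, $$f_H(x)=\frac{1}{\sqrt{\theta_1^2+4\theta_2x}}\exp\left(\frac{1}{2\theta_2}\left(\theta_1-\sqrt{\theta_1^2+4\theta_2x}\right)\right),\qquad \theta_1=\gamma_2Pr^{-\alpha},\quad \theta_2=\tfrac32\gamma_4P^2r^{-2\alpha},$$ and for $\tau=0$ the first integral is interpreted as $0$.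
   Context: $h$ and $g$ are independent circularly symmetric complex Gaussian random variables $\mathcal{CN}(0,1)$, so that $|h|^2$ and $|g|^2$ are independent exponential random variables with mean $1$. The constants $P,r,B,\sigma^2,\xi,\psi,\gamma_2,\gamma_4$ are positive reals and $\alpha>2$. $E_1(x)=\int_x^\infty e^{-t}t^{-1}\,dt$ for $x>0$ is the exponential integral. $\epsilon$ is the harvested energy, a fraction $\tau$ of which is used for offloading and the rest for local computation; $\ell_o$ and $\ell_c$ are the resulting numbers of offloaded and locally computed bits. *)

theory Defs
  imports "HOL-Probability.Probability"
begin

text \<open>
  Circularly symmetric complex Gaussian \<open>CN(0, v)\<close>: real and imaginary parts are independent
  \<open>N(0, v/2)\<close>, so that \<open>E |Z|\<^sup>2 = v\<close>. Note that \<^const>\<open>normal_density\<close> is parameterised by the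
  standard deviation, not the variance.
\<close>

definition circ_sym_complex_gaussian :: "'a measure \<Rightarrow> real \<Rightarrow> ('a \<Rightarrow> complex) \<Rightarrow> bool" where
  "circ_sym_complex_gaussian M v Z \<longleftrightarrow>
     distributed M lborel (\<lambda>\<omega>. Re (Z \<omega>)) (normal_density 0 (sqrt (v / 2))) \<and>
     distributed M lborel (\<lambda>\<omega>. Im (Z \<omega>)) (normal_density 0 (sqrt (v / 2))) \<and>
     prob_space.indep_var M borel (\<lambda>\<omega>. Re (Z \<omega>)) borel (\<lambda>\<omega>. Im (Z \<omega>))"

text \<open>Only meaningful for \<open>x > 0\<close>; otherwise the integrand is not integrable.\<close>

definition E\<^sub>1 :: "real \<Rightarrow> real" where
  "E\<^sub>1 x = (LBINT t:{x..}. exp (- t) / t)"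

definition f\<^sub>H :: "real \<Rightarrow> real \<Rightarrow> real \<Rightarrow> real" where
  "f\<^sub>H \<theta>\<^sub>1 \<theta>\<^sub>2 x =
     1 / sqrt (\<theta>\<^sub>1\<^sup>2 + 4 * \<theta>\<^sub>2 * x) *
     exp (1 / (2 * \<theta>\<^sub>2) * (\<theta>\<^sub>1 - sqrt (\<theta>\<^sub>1\<^sup>2 + 4 * \<theta>\<^sub>2 * x)))"

end

theory Submission imports Defs begin

text \<open>
  The harvested energy is \<open>t\<^sub>e H\<close> with \<open>H = \<theta>\<^sub>1 X + \<theta>\<^sub>2 X\<^sup>2\<close> and \<open>X = |h|\<^sup>2\<close> exponential, and inverting the
  quadratic shows that \<open>H\<close> has density \<open>f\<^sub>H\<close>. Conditionally on \<open>H = x\<close>, the expectation of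
  \<open>ln (1 + x |g|\<^sup>2 / k)\<close> over the exponential variable \<open>|g|\<^sup>2\<close> is \<open>exp (k / x) E\<^sub>1 (k / x)\<close>, so the
  formula follows from Fubini; \<open>ln (1 + z) \<le> z\<close> supplies integrability.
\<close>

section \<open>The squared modulus of a circularly symmetric Gaussian\<close>

lemma nn_integral_even_function:
  fixes f :: "real \<Rightarrow> ennreal"
  assumes [measurable]: "f \<in> borel_measurable borel" and even: "\<And>x. f (- x) = f x"
  shows "(\<integral>\<^sup>+x. f x \<partial>lborel) = 2 * (\<integral>\<^sup>+x. f x * indicator {0..} x \<partial>lborel)"
proof -
  have "(\<integral>\<^sup>+x. f x \<partial>lborel) = (\<integral>\<^sup>+x. f x * indicator {0..} x + f x * indicator {..<0} x \<partial>lborel)"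
    by (intro nn_integral_cong) (auto split: split_indicator)
  also have "\<dots> = (\<integral>\<^sup>+x. f x * indicator {0..} x \<partial>lborel) + (\<integral>\<^sup>+x. f x * indicator {..<0} x \<partial>lborel)"
    by (rule nn_integral_add) auto
  also have "(\<integral>\<^sup>+x. f x * indicator {..<0} x \<partial>lborel) = (\<integral>\<^sup>+x. f (- x) * indicator {..<0} (- x) \<partial>lborel)"
    using nn_integral_real_affine[of "\<lambda>x. f x * indicator {..<0} x" "-1" 0] by simp
  \<comment> \<open>Reflection turns the open negative half-line into the open positive one, which
    differs from \<open>{0..}\<close> only in the null set \<open>{0}\<close>.\<close>
  also have "\<dots> = (\<integral>\<^sup>+x. f x * indicator {0..} x \<partial>lborel)"
    by (intro nn_integral_cong_AE AE_I[where N="{0}"]) (auto simp: even split: split_indicator)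
  finally show ?thesis
    by (simp add: mult_2)
qed

text \<open>The antiderivative is \<open>arctan\<close>, which tends to \<open>pi / 2\<close>. This
  is the factor that the slope \<open>s = y / x\<close> contributes to the Gaussian disc integral;
  it cancels the normalising constant \<open>1 / pi\<close>.\<close>

lemma nn_integral_inverse_one_plus_square:
  "(\<integral>\<^sup>+s. ennreal (1 / (1 + s\<^sup>2)) \<partial>lborel) = ennreal pi"
proof -
  have half: "(\<integral>\<^sup>+s. ennreal (1 / (1 + s\<^sup>2)) * indicator {0..} s \<partial>lborel) = ennreal (pi / 2 - arctan 0)"
    by (rule nn_integral_FTC_atLeast)
       (auto intro!: derivative_eq_intros tendsto_arctan_at_top simp: field_simps)
  have "(\<integral>\<^sup>+s. ennreal (1 / (1 + s\<^sup>2)) \<partial>lborel)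
      = 2 * (\<integral>\<^sup>+s. ennreal (1 / (1 + s\<^sup>2)) * indicator {0..} s \<partial>lborel)"
    by (rule nn_integral_even_function) auto
  also have "\<dots> = ennreal 2 * ennreal (pi / 2)"
    unfolding half by simp
  also have "\<dots> = ennreal pi"
    by (subst ennreal_mult[symmetric]) auto
  finally show ?thesis .
qed

text \<open>The factor \<open>\<bar>x\<bar>\<close>, which arises as the Jacobian of
  \<open>y = x s\<close>, makes the integrand elementary: on the positive half-line
  \<open>- exp (- (x\<^sup>2 * k)) / (2 * k)\<close> is an antiderivative, and evenness supplies the
  factor 2. The case of interest is \<open>k = 1 + s\<^sup>2\<close>.\<close>

lemma nn_integral_abs_times_gaussian_ball:
  fixes a k :: real
  assumes a: "0 \<le> a" and k: "0 < k"
  shows "(\<integral>\<^sup>+x. ennreal (\<bar>x\<bar> * exp (- (x\<^sup>2 * k))) * indicator {x. x\<^sup>2 * k \<le> a} x \<partial>lborel)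
       = ennreal ((1 - exp (- a)) / k)"
proof -
  \<comment> \<open>For nonnegative \<open>x\<close>, the constraint
    \<open>x\<^sup>2 * k \<le> a\<close> describes exactly the interval from 0 to
    \<open>b\<close>.\<close>
  define b where "b = sqrt (a / k)"
  have b: "0 \<le> b" "b\<^sup>2 * k = a"
    using a k by (auto simp: b_def)
  have le_b: "x\<^sup>2 * k \<le> a \<longleftrightarrow> x \<le> b" if "0 \<le> x" for x
  proof -
    have "x\<^sup>2 * k \<le> a \<longleftrightarrow> x\<^sup>2 \<le> b\<^sup>2"
      using k b(2) by (metis mult_le_cancel_right_pos)
    then show ?thesis
      using that b(1) by (simp add: power_mono_iff)
  qed
  have "(\<integral>\<^sup>+x. ennreal (\<bar>x\<bar> * exp (- (x\<^sup>2 * k))) * indicator {x. x\<^sup>2 * k \<le> a} x \<partial>lborel)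
      = 2 * (\<integral>\<^sup>+x. ennreal (\<bar>x\<bar> * exp (- (x\<^sup>2 * k))) * indicator {x. x\<^sup>2 * k \<le> a} x * indicator {0..} x \<partial>lborel)"
    by (rule nn_integral_even_function) (auto split: split_indicator)
  also have "(\<integral>\<^sup>+x. ennreal (\<bar>x\<bar> * exp (- (x\<^sup>2 * k))) * indicator {x. x\<^sup>2 * k \<le> a} x * indicator {0..} x \<partial>lborel)
      = (\<integral>\<^sup>+x. ennreal (x * exp (- (x\<^sup>2 * k))) * indicator {0..b} x \<partial>lborel)"
    by (intro nn_integral_cong) (auto simp: le_b split: split_indicator)
  also have "\<dots> = ennreal (- exp (- (b\<^sup>2 * k)) / (2 * k) - (- exp (- (0\<^sup>2 * k)) / (2 * k)))"
    using k b by (intro nn_integral_FTC_Icc) (auto intro!: derivative_eq_intros)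
  also have "- exp (- (b\<^sup>2 * k)) / (2 * k) - (- exp (- (0\<^sup>2 * k)) / (2 * k)) = (1 - exp (- a)) / (2 * k)"
    by (simp add: b(2) diff_divide_distrib)
  also have "2 * ennreal ((1 - exp (- a)) / (2 * k)) = ennreal (2 * ((1 - exp (- a)) / (2 * k)))"
    using a k by (subst ennreal_mult) auto
  also have "2 * ((1 - exp (- a)) / (2 * k)) = (1 - exp (- a)) / k"
    using k by (simp add: field_simps)
  finally show ?thesis .
qed

text \<open>As in the classical evaluation of the Gaussian integral, the substitution \<open>y = x s\<close> replaces
  polar coordinates.\<close>
lemma nn_integral_gaussian_disc:
  fixes a :: real
  assumes a: "0 \<le> a"
  shows "(\<integral>\<^sup>+x. \<integral>\<^sup>+y. ennreal (exp (- (x\<^sup>2 + y\<^sup>2)) / pi) * indicator {p. (fst p)\<^sup>2 + (snd p)\<^sup>2 \<le> a} (x, y) \<partial>lborel \<partial>lborel)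
       = ennreal (1 - exp (- a))"
proof -
  \<comment> \<open>The integrand after \<open>y = x s\<close>, where the squared radius becomes
    \<open>x\<^sup>2 * (1 + s\<^sup>2)\<close>.\<close>
  let ?G = "\<lambda>x s. ennreal (\<bar>x\<bar> * exp (- (x\<^sup>2 * (1 + s\<^sup>2)))) * indicator {x. x\<^sup>2 * (1 + s\<^sup>2) \<le> a} x * ennreal (1 / pi)"
  have "(\<integral>\<^sup>+x. \<integral>\<^sup>+y. ennreal (exp (- (x\<^sup>2 + y\<^sup>2)) / pi) * indicator {p. (fst p)\<^sup>2 + (snd p)\<^sup>2 \<le> a} (x, y) \<partial>lborel \<partial>lborel)
      = (\<integral>\<^sup>+x. \<integral>\<^sup>+s. ?G x s \<partial>lborel \<partial>lborel)"
  \<comment> \<open>The substitution degenerates at \<open>x = 0\<close>, so the inner integrals are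
    compared only off this null set.\<close>
  proof (intro nn_integral_cong_AE AE_I[where N="{0}"] subsetI)
    fix x :: real
    assume "x \<in> {x \<in> space lborel. (\<integral>\<^sup>+y. ennreal (exp (- (x\<^sup>2 + y\<^sup>2)) / pi) *
        indicator {p. (fst p)\<^sup>2 + (snd p)\<^sup>2 \<le> a} (x, y) \<partial>lborel) \<noteq> (\<integral>\<^sup>+s. ?G x s \<partial>lborel)}"
    moreover have "(\<integral>\<^sup>+y. ennreal (exp (- (x\<^sup>2 + y\<^sup>2)) / pi) *
        indicator {p. (fst p)\<^sup>2 + (snd p)\<^sup>2 \<le> a} (x, y) \<partial>lborel) = (\<integral>\<^sup>+s. ?G x s \<partial>lborel)" if "x \<noteq> 0"
    proof -
      have "(\<integral>\<^sup>+y. ennreal (exp (- (x\<^sup>2 + y\<^sup>2)) / pi) * indicator {p. (fst p)\<^sup>2 + (snd p)\<^sup>2 \<le> a} (x, y) \<partial>lborel)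
          = ennreal \<bar>x\<bar> * (\<integral>\<^sup>+s. ennreal (exp (- (x\<^sup>2 + (0 + x * s)\<^sup>2)) / pi) *
              indicator {p. (fst p)\<^sup>2 + (snd p)\<^sup>2 \<le> a} (x, 0 + x * s) \<partial>lborel)"
        using that by (intro nn_integral_real_affine) measurable
      also have "\<dots> = (\<integral>\<^sup>+s. ?G x s \<partial>lborel)"
        by (subst nn_integral_cmult[symmetric])
           (auto intro!: nn_integral_cong simp: ennreal_mult[symmetric] algebra_simps power_mult_distrib
                 split: split_indicator)
      finally show ?thesis .
    qed
    ultimately show "x \<in> {0}" by auto
  qed auto
  \<comment> \<open>With \<open>x\<close> innermost and the slope fixed, the preceding evaluation
    applies.\<close>
  also have "\<dots> = (\<integral>\<^sup>+s. \<integral>\<^sup>+x. ?G x s \<partial>lborel \<partial>lborel)"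
    by (rule lborel_pair.Fubini'[symmetric]) measurable
  also have "\<dots> = (\<integral>\<^sup>+s. ennreal (1 / (1 + s\<^sup>2)) * ennreal ((1 - exp (- a)) / pi) \<partial>lborel)"
  proof (rule nn_integral_cong)
    fix s :: real
    have pos: "0 < 1 + s\<^sup>2" by (simp add: add_pos_nonneg)
    have "(\<integral>\<^sup>+x. ?G x s \<partial>lborel) = ennreal ((1 - exp (- a)) / (1 + s\<^sup>2)) * ennreal (1 / pi)"
      by (subst nn_integral_multc) (simp_all add: nn_integral_abs_times_gaussian_ball[OF a pos])
    also have "\<dots> = ennreal (1 / (1 + s\<^sup>2)) * ennreal ((1 - exp (- a)) / pi)"
      using a pos by (simp add: ennreal_mult[symmetric])
    finally show "(\<integral>\<^sup>+x. ?G x s \<partial>lborel) = ennreal (1 / (1 + s\<^sup>2)) * ennreal ((1 - exp (- a)) / pi)" .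
  qed
  also have "\<dots> = ennreal pi * ennreal ((1 - exp (- a)) / pi)"
    by (subst nn_integral_multc) (simp_all add: nn_integral_inverse_one_plus_square)
  also have "\<dots> = ennreal (1 - exp (- a))"
    using a by (simp add: ennreal_mult[symmetric])
  finally show ?thesis .
qed

text \<open>The joint density of the real and imaginary parts is
  \<open>exp (- (x\<^sup>2 + y\<^sup>2)) / pi\<close>, so the probability of the disc of squared
  radius \<open>a\<close> is \<open>1 - exp (- a)\<close>, the distribution function of the
  exponential law of rate 1.\<close>

lemma (in prob_space) circ_sym_complex_gaussian_cmod_square:
  assumes "circ_sym_complex_gaussian M 1 Z"
  shows "distributed M lborel (\<lambda>\<omega>. (cmod (Z \<omega>))\<^sup>2) (exponential_density 1)"
proof (rule exponential_distributedI)
  let ?X = "\<lambda>\<omega>. Re (Z \<omega>)" and ?Y = "\<lambda>\<omega>. Im (Z \<omega>)"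
  let ?n = "normal_density 0 (sqrt (1 / 2))"
  have X: "distributed M lborel ?X ?n" and Y: "distributed M lborel ?Y ?n"
    and ind: "indep_var borel ?X borel ?Y"
    using assms by (auto simp: circ_sym_complex_gaussian_def)
  have [measurable]: "?X \<in> borel_measurable M" "?Y \<in> borel_measurable M"
    using distributed_measurable[OF X] distributed_measurable[OF Y] by simp_all
  \<comment> \<open>The joint density rule takes the reference measures as targets;
    \<open>lborel\<close> and \<open>borel\<close> have the same measurable sets.\<close>
  have "indep_var lborel ?X lborel ?Y"
    using ind by (simp add: indep_var_eq)
  then have XY: "distributed M (lborel \<Otimes>\<^sub>M lborel) (\<lambda>\<omega>. (?X \<omega>, ?Y \<omega>)) (\<lambda>(x, y). ?n x * ?n y)"
    using distributed_joint_indep[OF lborel.sigma_finite_measure_axioms lborel.sigma_finite_measure_axioms X Y]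
    by (simp add: ennreal_mult case_prod_beta')
  have density: "?n x * ?n y = exp (- (x\<^sup>2 + y\<^sup>2)) / pi" for x y
    by (simp add: normal_density_def exp_add[symmetric] field_simps)
  show "(\<lambda>\<omega>. (cmod (Z \<omega>))\<^sup>2) \<in> borel_measurable M"
    by (simp add: cmod_power2)
  fix a :: real assume a: "0 \<le> a"
  have "emeasure M {\<omega> \<in> space M. (cmod (Z \<omega>))\<^sup>2 \<le> a}
      = (\<integral>\<^sup>+\<omega>. indicator {p. (fst p)\<^sup>2 + (snd p)\<^sup>2 \<le> a} (?X \<omega>, ?Y \<omega>) \<partial>M)"
  proof -
    have "(\<integral>\<^sup>+\<omega>. indicator {p. (fst p)\<^sup>2 + (snd p)\<^sup>2 \<le> a} (?X \<omega>, ?Y \<omega>) \<partial>M)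
        = (\<integral>\<^sup>+\<omega>. indicator {\<omega> \<in> space M. (cmod (Z \<omega>))\<^sup>2 \<le> a} \<omega> \<partial>M)"
      by (rule nn_integral_cong) (simp add: cmod_power2 indicator_def)
    then show ?thesis
      by (simp add: cmod_power2)
  qed
  also have "\<dots> = (\<integral>\<^sup>+p. ennreal (case p of (x, y) \<Rightarrow> ?n x * ?n y) * indicator {p. (fst p)\<^sup>2 + (snd p)\<^sup>2 \<le> a} p
                    \<partial>(lborel \<Otimes>\<^sub>M lborel))"
    by (rule distributed_nn_integral[OF XY, symmetric]) measurable
  also have "\<dots> = (\<integral>\<^sup>+x. \<integral>\<^sup>+y. ennreal (exp (- (x\<^sup>2 + y\<^sup>2)) / pi) *
                    indicator {p. (fst p)\<^sup>2 + (snd p)\<^sup>2 \<le> a} (x, y) \<partial>lborel \<partial>lborel)"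
    by (subst lborel.nn_integral_fst[symmetric]) (simp_all add: density)
  also have "\<dots> = 1 - ennreal (exp (- a * 1))"
    unfolding nn_integral_gaussian_disc[OF a] by (simp add: ennreal_minus[symmetric])
  finally show "emeasure M {\<omega> \<in> space M. (cmod (Z \<omega>))\<^sup>2 \<le> a} = 1 - ennreal (exp (- a * 1))" .
qed simp

section \<open>The density of the harvested energy\<close>

text \<open>Both sides have the distribution function \<open>1 - exp (- u a)\<close> for
  \<open>a \<ge> 0\<close> and 0 for \<open>a < 0\<close>: the law because the quadratic is
  increasing on the nonnegative reals with inverse \<open>u\<close>, the density because
  \<open>- exp (- u x)\<close> is an antiderivative of it.\<close>

lemma (in prob_space) distributed_f\<^sub>H:
  fixes \<theta>\<^sub>1 \<theta>\<^sub>2 :: real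
  assumes X: "distributed M lborel X (exponential_density 1)"
    and pos: "0 < \<theta>\<^sub>1" "0 < \<theta>\<^sub>2"
  shows "distributed M lborel (\<lambda>\<omega>. \<theta>\<^sub>1 * X \<omega> + \<theta>\<^sub>2 * (X \<omega>)\<^sup>2) (\<lambda>x. indicator {0<..} x * f\<^sub>H \<theta>\<^sub>1 \<theta>\<^sub>2 x)"
proof (rule distributedI_borel_atMost)
  \<comment> \<open>the inverse of \<open>y \<mapsto> \<theta>\<^sub>1 y + \<theta>\<^sub>2 y\<^sup>2\<close> on the nonnegative reals\<close>
  define u where "u x = 1 / (2 * \<theta>\<^sub>2) * (sqrt (\<theta>\<^sub>1\<^sup>2 + 4 * \<theta>\<^sub>2 * x) - \<theta>\<^sub>1)" for x
  have [measurable]: "X \<in> borel_measurable M"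
    using distributed_measurable[OF X] by simp
  have [measurable]: "f\<^sub>H \<theta>\<^sub>1 \<theta>\<^sub>2 \<in> borel_measurable borel"
    unfolding f\<^sub>H_def[abs_def] by measurable
  show "(\<lambda>\<omega>. \<theta>\<^sub>1 * X \<omega> + \<theta>\<^sub>2 * (X \<omega>)\<^sup>2) \<in> borel_measurable M"
    "(\<lambda>x. indicator {0<..} x * f\<^sub>H \<theta>\<^sub>1 \<theta>\<^sub>2 x) \<in> borel_measurable borel"
    by measurable
  have disc: "0 < \<theta>\<^sub>1\<^sup>2 + 4 * \<theta>\<^sub>2 * x" if "0 \<le> x" for x
    using pos that by (simp add: add_pos_nonneg)
  have f\<^sub>H_nonneg: "0 \<le> f\<^sub>H \<theta>\<^sub>1 \<theta>\<^sub>2 x" if "0 \<le> x" for x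
    using disc[OF that] by (simp add: f\<^sub>H_def)
  then show "AE x in lborel. 0 \<le> indicator {0<..} x * f\<^sub>H \<theta>\<^sub>1 \<theta>\<^sub>2 x"
    by (auto split: split_indicator)
  have u0: "u 0 = 0"
    using pos by (simp add: u_def)
  \<comment> \<open>Only the law of \<open>X\<close> is given, so its sign is known almost
    everywhere, and the events below are compared up to null sets.\<close>
  have AE_nonneg: "AE \<omega> in M. 0 \<le> X \<omega>"
    by (subst distributed_AE2[OF X]) (auto simp: exponential_density_def)
  fix a :: real
  show "(\<integral>\<^sup>+x. ennreal (indicator {0<..} x * f\<^sub>H \<theta>\<^sub>1 \<theta>\<^sub>2 x * indicator {..a} x) \<partial>lborel)
      = ennreal (if a < 0 then 0 else 1 - exp (- u a))"
  proof (cases "a < 0")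
    case True
    then have "(\<integral>\<^sup>+x. ennreal (indicator {0<..} x * f\<^sub>H \<theta>\<^sub>1 \<theta>\<^sub>2 x * indicator {..a} x) \<partial>lborel) = (\<integral>\<^sup>+(x::real). 0 \<partial>lborel)"
      by (intro nn_integral_cong) (auto split: split_indicator)
    with True show ?thesis by simp
  next
    case False
    \<comment> \<open>The derivative of \<open>u\<close> is the reciprocal square root in
      \<open>f\<^sub>H\<close>, and \<open>exp (- u x)\<close> is its exponential factor.\<close>
    have deriv: "((\<lambda>x. - exp (- u x)) has_field_derivative f\<^sub>H \<theta>\<^sub>1 \<theta>\<^sub>2 x) (at x)" if "0 \<le> x" for x
      unfolding u_def f\<^sub>H_def using disc[OF that] pos
      by (auto intro!: derivative_eq_intros simp: field_simps)
    have "(\<integral>\<^sup>+x. ennreal (indicator {0<..} x * f\<^sub>H \<theta>\<^sub>1 \<theta>\<^sub>2 x * indicator {..a} x) \<partial>lborel)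
        = (\<integral>\<^sup>+x. ennreal (f\<^sub>H \<theta>\<^sub>1 \<theta>\<^sub>2 x) * indicator {0..a} x \<partial>lborel)"
      by (intro nn_integral_cong_AE AE_I[where N="{0}"]) (auto split: split_indicator)
    also have "\<dots> = ennreal (- exp (- u a) - - exp (- u 0))"
      using False by (intro nn_integral_FTC_Icc deriv f\<^sub>H_nonneg) auto
    finally show ?thesis
      using False by (simp add: u0)
  qed
  show "emeasure M {\<omega> \<in> space M. \<theta>\<^sub>1 * X \<omega> + \<theta>\<^sub>2 * (X \<omega>)\<^sup>2 \<le> a}
      = ennreal (if a < 0 then 0 else 1 - exp (- u a))"
  proof (cases "a < 0")
    case True
    have "AE \<omega> in M. \<not> (\<theta>\<^sub>1 * X \<omega> + \<theta>\<^sub>2 * (X \<omega>)\<^sup>2 \<le> a)"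
      using AE_nonneg
    proof eventually_elim
      case (elim \<omega>)
      then have "0 \<le> \<theta>\<^sub>1 * X \<omega> + \<theta>\<^sub>2 * (X \<omega>)\<^sup>2" using pos by simp
      with True show ?case by simp
    qed
    then have "emeasure M {\<omega> \<in> space M. \<theta>\<^sub>1 * X \<omega> + \<theta>\<^sub>2 * (X \<omega>)\<^sup>2 \<le> a} = 0"
      by (subst (asm) AE_iff_measurable[OF _ refl]) auto
    with True show ?thesis by simp
  next
    case False
    have "sqrt (\<theta>\<^sub>1\<^sup>2) \<le> sqrt (\<theta>\<^sub>1\<^sup>2 + 4 * \<theta>\<^sub>2 * a)"
      using False pos by (intro real_sqrt_le_mono) simp
    then have ua: "0 \<le> u a"
      using pos by (simp add: u_def)
    \<comment> \<open>Squaring removes the radical and shows that \<open>u a\<close> solves the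
      quadratic equation with right-hand side \<open>a\<close>.\<close>
    have "2 * \<theta>\<^sub>2 * u a + \<theta>\<^sub>1 = sqrt (\<theta>\<^sub>1\<^sup>2 + 4 * \<theta>\<^sub>2 * a)"
      using pos by (simp add: u_def)
    then have "(2 * \<theta>\<^sub>2 * u a + \<theta>\<^sub>1)\<^sup>2 = \<theta>\<^sub>1\<^sup>2 + 4 * \<theta>\<^sub>2 * a"
      using disc[of a] False by simp
    then have "4 * \<theta>\<^sub>2 * (\<theta>\<^sub>1 * u a + \<theta>\<^sub>2 * (u a)\<^sup>2) = 4 * \<theta>\<^sub>2 * a"
      by (simp add: power2_eq_square algebra_simps)
    then have root: "\<theta>\<^sub>1 * u a + \<theta>\<^sub>2 * (u a)\<^sup>2 = a"
      using pos by simp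
    have "\<theta>\<^sub>1 * x + \<theta>\<^sub>2 * x\<^sup>2 \<le> a \<longleftrightarrow> x \<le> u a" if "0 \<le> x" for x
    proof -
      \<comment> \<open>Once \<open>a\<close> is replaced by the quadratic at \<open>u a\<close>,
        the difference has the factor \<open>u a - x\<close>; the cofactor is positive, so this
        factor decides the sign.\<close>
      have "a - (\<theta>\<^sub>1 * x + \<theta>\<^sub>2 * x\<^sup>2) = (u a - x) * (\<theta>\<^sub>1 + \<theta>\<^sub>2 * (u a + x))"
        by (subst root[symmetric]) (simp add: power2_eq_square algebra_simps)
      moreover have "0 < \<theta>\<^sub>1 + \<theta>\<^sub>2 * (u a + x)"
        using pos that ua by (simp add: add_pos_nonneg)
      ultimately show ?thesis
        by (metis diff_ge_0_iff_ge zero_le_mult_iff linorder_not_less order_less_imp_le)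
    qed
    then have "emeasure M {\<omega> \<in> space M. \<theta>\<^sub>1 * X \<omega> + \<theta>\<^sub>2 * (X \<omega>)\<^sup>2 \<le> a} = emeasure M {\<omega> \<in> space M. X \<omega> \<le> u a}"
      using AE_nonneg by (intro emeasure_eq_AE) (auto elim!: eventually_mono)
    also have "\<dots> = ennreal (1 - exp (- u a))"
      using X ua by (simp add: exponential_distributed_iff emeasure_eq_measure)
    finally show ?thesis
      using False by simp
  qed
qed

section \<open>The exponential integral as an average logarithm\<close>

text \<open>Write \<open>ln (1 + y / k)\<close> as \<open>\<integral>\<^sub>0\<^sup>y 1 / (k + s) ds\<close> and exchange the integrals.\<close>
lemma integral_exponential_ln:
  assumes k: "0 < k"
  shows "(LBINT y. exponential_density 1 y * ln (1 + y / k)) = exp k * E\<^sub>1 k"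
proof -
  \<comment> \<open>On \<open>{k..}\<close> one has \<open>1 / t \<le> 1 / k\<close>, so the
    exponential density divided by \<open>k\<close> dominates; the zeroth Erlang moment shows that
    this density is integrable.\<close>
  have dom: "integrable lborel (\<lambda>t. indicator {k..} t *\<^sub>R (exp (- t) / t))"
  proof (rule Bochner_Integration.integrable_bound)
    have "integrable lborel (\<lambda>t. exponential_density 1 t)"
      using nn_integral_erlang_ith_moment[of 1 0 0]
      by (intro integrableI_nonneg) auto
    then show "integrable lborel (\<lambda>t. exponential_density 1 t / k)" by simp
    show "AE t in lborel. norm (indicator {k..} t *\<^sub>R (exp (- t) / t)) \<le> norm (exponential_density 1 t / k)"
      using k by (auto simp: exponential_density_def intro!: divide_left_mono split: split_indicator)
  qed auto
  have E\<^sub>1_nonneg: "0 \<le> E\<^sub>1 k"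
    unfolding E\<^sub>1_def set_lebesgue_integral_def
    using k by (intro integral_nonneg_AE) (auto split: split_indicator)
  have "ennreal (E\<^sub>1 k) = (\<integral>\<^sup>+t. ennreal (exp (- t) / t) * indicator {k..} t \<partial>lborel)"
    unfolding E\<^sub>1_def set_lebesgue_integral_def using k
    by (subst nn_integral_eq_integral[OF dom, symmetric])
       (auto intro!: nn_integral_cong split: split_indicator)
  \<comment> \<open>The shift \<open>t = k + s\<close> isolates a factor \<open>exp (- k)\<close>,
    which the prefactor \<open>exp k\<close> then cancels.\<close>
  also have "\<dots> = (\<integral>\<^sup>+s. ennreal (exp (- (k + s)) / (k + s)) * indicator {0..} s \<partial>lborel)"
    by (subst nn_integral_real_affine[where c=1 and t=k])
       (auto intro!: nn_integral_cong split: split_indicator)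
  finally have "ennreal (exp k * E\<^sub>1 k) = ennreal (exp k) * \<dots>"
    using E\<^sub>1_nonneg by (simp add: ennreal_mult)
  also have "\<dots> = (\<integral>\<^sup>+s. ennreal (1 / (k + s)) * indicator {0..} s * ennreal (exp (- s)) \<partial>lborel)"
  proof (subst nn_integral_cmult[symmetric])
    have "exp k * exp (- k - s) = exp (- s)" for s
      by (simp add: exp_add[symmetric])
    then show "(\<integral>\<^sup>+s. ennreal (exp k) * (ennreal (exp (- (k + s)) / (k + s)) * indicator {0..} s) \<partial>lborel)
      = (\<integral>\<^sup>+s. ennreal (1 / (k + s)) * indicator {0..} s * ennreal (exp (- s)) \<partial>lborel)"
      using k by (intro nn_integral_cong) (auto simp: ennreal_mult[symmetric] split: split_indicator)
  qed measurable
  \<comment> \<open>Writing \<open>exp (- s)\<close> as the integral of \<open>exp (- y)\<close>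
    over \<open>y \<ge> s\<close> gives a double integral over \<open>0 \<le> s \<le> y\<close>,
    whose order can be exchanged.\<close>
  also have "\<dots> = (\<integral>\<^sup>+s. \<integral>\<^sup>+y. ennreal (1 / (k + s)) * indicator {0..} s *
                    (ennreal (exp (- y)) * indicator {p. fst p \<le> snd p} (s, y)) \<partial>lborel \<partial>lborel)"
  proof (rule nn_integral_cong)
    fix s :: real
    have "(\<integral>\<^sup>+y. ennreal (exp (- y)) * indicator {s..} y \<partial>lborel) = ennreal (0 - - exp (- s))"
    proof (rule nn_integral_FTC_atLeast)
      show "((\<lambda>y. - exp (- y :: real)) \<longlongrightarrow> 0) at_top"
        using tendsto_minus[OF filterlim_compose[OF exp_at_bot filterlim_uminus_at_bot_at_top]] by simp
    qed (auto intro!: derivative_eq_intros)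
    then have "(\<integral>\<^sup>+y. ennreal (exp (- y)) * indicator {p. fst p \<le> snd p} (s, y) \<partial>lborel) = ennreal (exp (- s))"
      by (simp add: indicator_def)
    then show "ennreal (1 / (k + s)) * indicator {0..} s * ennreal (exp (- s)) =
      (\<integral>\<^sup>+y. ennreal (1 / (k + s)) * indicator {0..} s *
         (ennreal (exp (- y)) * indicator {p. fst p \<le> snd p} (s, y)) \<partial>lborel)"
      by (subst nn_integral_cmult) simp_all
  qed
  also have "\<dots> = (\<integral>\<^sup>+y. \<integral>\<^sup>+s. ennreal (1 / (k + s)) * indicator {0..} s *
                    (ennreal (exp (- y)) * indicator {p. fst p \<le> snd p} (s, y)) \<partial>lborel \<partial>lborel)"
    by (rule lborel_pair.Fubini'[symmetric]) measurable
  also have "\<dots> = (\<integral>\<^sup>+y. ennreal (exponential_density 1 y * ln (1 + y / k)) \<partial>lborel)"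
  proof (rule nn_integral_cong)
    fix y :: real
    have "(\<integral>\<^sup>+s. ennreal (1 / (k + s)) * indicator {0..} s *
             (ennreal (exp (- y)) * indicator {p. fst p \<le> snd p} (s, y)) \<partial>lborel)
        = (\<integral>\<^sup>+s. ennreal (exp (- y)) * (ennreal (1 / (k + s)) * indicator {0..y} s) \<partial>lborel)"
      by (intro nn_integral_cong) (auto simp: mult.commute split: split_indicator)
    also have "\<dots> = ennreal (exp (- y)) * (\<integral>\<^sup>+s. ennreal (1 / (k + s)) * indicator {0..y} s \<partial>lborel)"
      by (rule nn_integral_cmult) measurable
    also have "\<dots> = ennreal (exponential_density 1 y * ln (1 + y / k))"
    \<comment> \<open>For negative \<open>y\<close> the interval \<open>{0..y}\<close> is empty and
      the exponential density vanishes, so both sides are 0.\<close>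
    proof (cases "0 \<le> y")
      case True
      have "(\<integral>\<^sup>+s. ennreal (1 / (k + s)) * indicator {0..y} s \<partial>lborel) = ennreal (ln (k + y) - ln (k + 0))"
        using k True by (intro nn_integral_FTC_Icc) (auto intro!: derivative_eq_intros)
      also have "ln (k + y) - ln (k + 0) = ln (1 + y / k)"
        using k True ln_div[of "k + y" k] by (simp add: add_divide_distrib)
      finally show ?thesis
        using k True by (simp add: exponential_density_def ennreal_mult)
    qed (simp add: exponential_density_def)
    finally show "(\<integral>\<^sup>+s. ennreal (1 / (k + s)) * indicator {0..} s *
        (ennreal (exp (- y)) * indicator {p. fst p \<le> snd p} (s, y)) \<partial>lborel)
      = ennreal (exponential_density 1 y * ln (1 + y / k))" .
  qed
  finally have "(\<integral>\<^sup>+y. ennreal (exponential_density 1 y * ln (1 + y / k)) \<partial>lborel) = ennreal (exp k * E\<^sub>1 k)" ..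
  then have "has_bochner_integral lborel (\<lambda>y. exponential_density 1 y * ln (1 + y / k)) (exp k * E\<^sub>1 k)"
    using k E\<^sub>1_nonneg
    by (intro has_bochner_integral_nn_integral) (auto simp: exponential_density_def)
  then show ?thesis
    by (rule has_bochner_integral_integral_eq)
qed

section \<open>Averaging over the harvested energy\<close>

text \<open>Independence makes the joint density a product, and Fubini integrates out
  \<open>G\<close> first. For fixed \<open>x > 0\<close> the inner integral is the exponential
  average of \<open>ln (1 + y / (k / x))\<close>, which accounts for the argument
  \<open>k / x\<close> of \<open>E\<^sub>1\<close>.\<close>

lemma (in prob_space)
  fixes H G :: "'a \<Rightarrow> real" and f :: "real \<Rightarrow> real"
  assumes H: "distributed M lborel H (\<lambda>x. indicator {0<..} x * f x)"
    and G: "distributed M lborel G (exponential_density 1)"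
    and indep: "indep_var borel H borel G"
    and f_nonneg: "\<And>x. 0 < x \<Longrightarrow> 0 \<le> f x"
    and nonneg: "\<And>\<omega>. 0 \<le> H \<omega>" "\<And>\<omega>. 0 \<le> G \<omega>"
    and int_H: "integrable M H"
    and k: "0 < k"
  shows integrable_ln_exponential_product:
      "integrable M (\<lambda>\<omega>. ln (1 + H \<omega> * G \<omega> / k))"
    and set_integrable_exp_E\<^sub>1:
      "set_integrable lborel {0<..} (\<lambda>x. exp (k / x) * E\<^sub>1 (k / x) * f x)"
    and expectation_ln_exponential_product:
      "expectation (\<lambda>\<omega>. ln (1 + H \<omega> * G \<omega> / k)) = (LBINT x:{0<..}. exp (k / x) * E\<^sub>1 (k / x) * f x)"
proof -
  let ?d = "\<lambda>(x, y). indicator {0<..} x * f x * exponential_density 1 y"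
  let ?l = "\<lambda>(x, y). ln (1 + x * y / k)"
  have [measurable]: "H \<in> borel_measurable M" "G \<in> borel_measurable M"
    using distributed_measurable[OF H] distributed_measurable[OF G] by simp_all
  \<comment> \<open>By independence, finite first moments of \<open>H\<close> and \<open>G\<close>
    make the product integrable; it dominates the logarithm through
    \<open>ln (1 + z) \<le> z\<close>.\<close>
  have int_HG: "integrable M (\<lambda>\<omega>. H \<omega> * G \<omega> / k)"
    using indep_var_integrable[OF indep int_H] erlang_ith_moment_integrable[OF _ G, of 1] by simp
  show int_ln: "integrable M (\<lambda>\<omega>. ln (1 + H \<omega> * G \<omega> / k))"
  proof (rule Bochner_Integration.integrable_bound[OF int_HG])
    show "AE \<omega> in M. norm (ln (1 + H \<omega> * G \<omega> / k)) \<le> norm (H \<omega> * G \<omega> / k)"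
      using k nonneg by (auto simp: ln_add_one_self_le_self)
  qed measurable
  have "indep_var lborel H lborel G"
    using indep by (simp add: indep_var_eq)
  then have joint: "distributed M (lborel \<Otimes>\<^sub>M lborel) (\<lambda>\<omega>. (H \<omega>, G \<omega>)) (\<lambda>p. ennreal (?d p))"
    using distributed_joint_indep[OF lborel.sigma_finite_measure_axioms lborel.sigma_finite_measure_axioms H G] f_nonneg
    by (simp add: ennreal_mult'' case_prod_beta')
  have d_nonneg: "0 \<le> ?d p" for p
    using f_nonneg by (auto split: prod.split split_indicator)
  have l_meas: "?l \<in> borel_measurable (lborel \<Otimes>\<^sub>M lborel)"
    by measurable
  have int_pair: "integrable (lborel \<Otimes>\<^sub>M lborel) (\<lambda>p. ?d p * ?l p)"
    using distributed_integrable[OF joint l_meas d_nonneg] int_ln by simp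
  \<comment> \<open>The indicator makes both sides 0 for \<open>x \<le> 0\<close>, where
    \<open>E\<^sub>1 (k / x)\<close> carries no meaning.\<close>
  have inner: "(LBINT y. ?d (x, y) * ?l (x, y)) = indicator {0<..} x *\<^sub>R (exp (k / x) * E\<^sub>1 (k / x) * f x)" for x
  proof (cases "0 < x")
    case True
    have "(LBINT y. ?d (x, y) * ?l (x, y)) = (LBINT y. f x * (exponential_density 1 y * ln (1 + y / (k / x))))"
      using True by (intro Bochner_Integration.integral_cong) (auto simp: mult_ac)
    also have "\<dots> = f x * (exp (k / x) * E\<^sub>1 (k / x))"
      using True k by (simp only: integral_mult_right_zero integral_exponential_ln[of "k / x"] divide_pos_pos)
    finally show ?thesis
      using True by simp
  qed simp
  \<comment> \<open>Fubini also gives integrability of the partially integrated function, which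
    \<open>inner\<close> identifies with the claimed integrand.\<close>
  show "set_integrable lborel {0<..} (\<lambda>x. exp (k / x) * E\<^sub>1 (k / x) * f x)"
    using lborel_pair.integrable_fst'[OF int_pair] unfolding inner set_integrable_def .
  have "expectation (\<lambda>\<omega>. ln (1 + H \<omega> * G \<omega> / k)) = integral\<^sup>L (lborel \<Otimes>\<^sub>M lborel) (\<lambda>p. ?d p * ?l p)"
    using distributed_integral[OF joint l_meas d_nonneg] by simp
  also have "\<dots> = (LBINT x. LBINT y. ?d (x, y) * ?l (x, y))"
    by (rule lborel_pair.integral_fst'[OF int_pair, symmetric])
  finally show "expectation (\<lambda>\<omega>. ln (1 + H \<omega> * G \<omega> / k)) = (LBINT x:{0<..}. exp (k / x) * E\<^sub>1 (k / x) * f x)"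
    unfolding inner set_lebesgue_integral_def .
qed

text \<open>Up to 1 the power is at most 1, and beyond 1 it is at most \<open>x\<close>. This makes
  the cube root of the energy integrable.\<close>

lemma powr_le_one_plus:
  fixes x p :: real
  assumes "0 \<le> x" "0 \<le> p" "p \<le> 1"
  shows "x powr p \<le> 1 + x"
proof (cases "x \<le> 1")
  case True
  then have "x powr p \<le> 1" using assms by (simp add: powr_le1)
  with assms show ?thesis by simp
next
  case False
  then have "x powr p \<le> x powr 1" using assms by (intro powr_mono) auto
  with False show ?thesis by simp
qed

text \<open>The bound by \<open>1 + H\<close> reduces integrability of the power to that of
  \<open>H\<close>; the two integral statements transfer the expectation to the density.\<close>

lemma (in prob_space)
  fixes H :: "'a \<Rightarrow> real" and f :: "real \<Rightarrow> real"
  assumes H: "distributed M lborel H (\<lambda>x. indicator {0<..} x * f x)"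
    and f_nonneg: "\<And>x. 0 < x \<Longrightarrow> 0 \<le> f x"
    and nonneg: "\<And>\<omega>. 0 \<le> H \<omega>"
    and int_H: "integrable M H"
    and p: "0 \<le> p" "p \<le> 1"
  shows integrable_powr: "integrable M (\<lambda>\<omega>. H \<omega> powr p)"
    and set_integrable_powr_density: "set_integrable lborel {0<..} (\<lambda>x. x powr p * f x)"
    and expectation_powr: "expectation (\<lambda>\<omega>. H \<omega> powr p) = (LBINT x:{0<..}. x powr p * f x)"
proof -
  have [measurable]: "H \<in> borel_measurable M"
    using distributed_measurable[OF H] by simp
  have "integrable M (\<lambda>\<omega>. 1 + H \<omega>)"
    using int_H by simp
  then show int: "integrable M (\<lambda>\<omega>. H \<omega> powr p)"
  proof (rule Bochner_Integration.integrable_bound)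
    show "AE \<omega> in M. norm (H \<omega> powr p) \<le> norm (1 + H \<omega>)"
      using powr_le_one_plus[OF nonneg p] nonneg by simp
  qed measurable
  have d_nonneg: "0 \<le> indicator {0<..} x * f x" for x
    using f_nonneg by (auto split: split_indicator)
  have powr_meas: "(\<lambda>x. x powr p) \<in> borel_measurable lborel"
    by measurable
  show "set_integrable lborel {0<..} (\<lambda>x. x powr p * f x)"
    using distributed_integrable[OF H powr_meas d_nonneg] int by (simp add: set_integrable_def mult_ac)
  show "expectation (\<lambda>\<omega>. H \<omega> powr p) = (LBINT x:{0<..}. x powr p * f x)"
    using distributed_integral[OF H powr_meas d_nonneg] by (simp add: set_lebesgue_integral_def mult_ac)
qed

section \<open>The average number of computed bits\<close>

theorem proposition1:
  fixes M :: "'a measure"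
    and h g :: "'a \<Rightarrow> complex"
    and P r B \<sigma> \<xi> \<psi> \<gamma>\<^sub>2 \<gamma>\<^sub>4 \<alpha> \<tau> t\<^sub>e t\<^sub>d \<theta>\<^sub>1 \<theta>\<^sub>2 :: real
    and \<epsilon> \<epsilon>\<^sub>o \<epsilon>\<^sub>c l\<^sub>o l\<^sub>c :: "'a \<Rightarrow> real"
  assumes "prob_space M"
    and "circ_sym_complex_gaussian M 1 h"
    and "circ_sym_complex_gaussian M 1 g"
    and "prob_space.indep_var M borel h borel g"
    and "P > 0" "r > 0" "B > 0" "\<sigma>\<^sup>2 > 0" "\<xi> > 0" "\<psi> > 0" "\<gamma>\<^sub>2 > 0" "\<gamma>\<^sub>4 > 0" "\<alpha> > 2"
    and "0 \<le> \<tau>" "\<tau> \<le> 1" "0 < t\<^sub>e" "t\<^sub>e < 1" "t\<^sub>d = 1 - t\<^sub>e"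
    and "\<epsilon> = (\<lambda>\<omega>. t\<^sub>e * (\<gamma>\<^sub>2 * P * r powr (- \<alpha>) * (cmod (h \<omega>))\<^sup>2
                 + 3 / 2 * \<gamma>\<^sub>4 * P\<^sup>2 * r powr (- 2 * \<alpha>) * (cmod (h \<omega>)) ^ 4))"
    and "\<epsilon>\<^sub>o = (\<lambda>\<omega>. \<tau> * \<epsilon> \<omega>)"
    and "\<epsilon>\<^sub>c = (\<lambda>\<omega>. (1 - \<tau>) * \<epsilon> \<omega>)"
    and "l\<^sub>o = (\<lambda>\<omega>. t\<^sub>d * B * log 2 (1 + \<epsilon>\<^sub>o \<omega> / t\<^sub>d * ((cmod (g \<omega>))\<^sup>2 / (r powr \<alpha> * \<sigma>\<^sup>2))))"
    and "l\<^sub>c = (\<lambda>\<omega>. (\<epsilon>\<^sub>c \<omega> / (\<xi> * \<psi> ^ 3)) powr (1 / 3))"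
    and "\<theta>\<^sub>1 = \<gamma>\<^sub>2 * P * r powr (- \<alpha>)"
    and "\<theta>\<^sub>2 = 3 / 2 * \<gamma>\<^sub>4 * P\<^sup>2 * r powr (- 2 * \<alpha>)"
  shows "integrable M (\<lambda>\<omega>. l\<^sub>o \<omega> + l\<^sub>c \<omega>)
    \<and> (\<tau> > 0 \<longrightarrow> set_integrable lborel {0<..}
           (\<lambda>x. exp (t\<^sub>d * r powr \<alpha> * \<sigma>\<^sup>2 / (\<tau> * t\<^sub>e * x))
              * E\<^sub>1 (t\<^sub>d * r powr \<alpha> * \<sigma>\<^sup>2 / (\<tau> * t\<^sub>e * x)) * f\<^sub>H \<theta>\<^sub>1 \<theta>\<^sub>2 x))
    \<and> set_integrable lborel {0<..} (\<lambda>x. x powr (1 / 3) * f\<^sub>H \<theta>\<^sub>1 \<theta>\<^sub>2 x)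
    \<and> prob_space.expectation M (\<lambda>\<omega>. l\<^sub>o \<omega> + l\<^sub>c \<omega>) =
           t\<^sub>d * B / ln 2 *
             (if \<tau> = 0 then 0
              else (LBINT x:{0<..}. exp (t\<^sub>d * r powr \<alpha> * \<sigma>\<^sup>2 / (\<tau> * t\<^sub>e * x))
                      * E\<^sub>1 (t\<^sub>d * r powr \<alpha> * \<sigma>\<^sup>2 / (\<tau> * t\<^sub>e * x)) * f\<^sub>H \<theta>\<^sub>1 \<theta>\<^sub>2 x))
           + ((1 - \<tau>) * t\<^sub>e / (\<xi> * \<psi> ^ 3)) powr (1 / 3)
             * (LBINT x:{0<..}. x powr (1 / 3) * f\<^sub>H \<theta>\<^sub>1 \<theta>\<^sub>2 x)"
proof -
  interpret prob_space M by (rule assms(1))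
  define X where "X \<omega> = (cmod (h \<omega>))\<^sup>2" for \<omega>
  define G where "G \<omega> = (cmod (g \<omega>))\<^sup>2" for \<omega>
  define H where "H \<omega> = \<theta>\<^sub>1 * X \<omega> + \<theta>\<^sub>2 * (X \<omega>)\<^sup>2" for \<omega>
  have pos: "0 < \<theta>\<^sub>1" "0 < \<theta>\<^sub>2" "0 < t\<^sub>d" "0 < r powr \<alpha>"
    using \<open>P > 0\<close> \<open>r > 0\<close> \<open>\<gamma>\<^sub>2 > 0\<close> \<open>\<gamma>\<^sub>4 > 0\<close> \<open>t\<^sub>e < 1\<close> \<open>t\<^sub>d = _\<close> by (simp_all add: \<open>\<theta>\<^sub>1 = _\<close> \<open>\<theta>\<^sub>2 = _\<close>)
  have X: "distributed M lborel X (exponential_density 1)" and G: "distributed M lborel G (exponential_density 1)"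
    unfolding X_def[abs_def] G_def[abs_def]
    using assms(2,3) by (simp_all add: circ_sym_complex_gaussian_cmod_square)
  have H: "distributed M lborel H (\<lambda>x. indicator {0<..} x * f\<^sub>H \<theta>\<^sub>1 \<theta>\<^sub>2 x)"
    unfolding H_def[abs_def] by (rule distributed_f\<^sub>H[OF X pos(1,2)])
  have nonneg: "0 \<le> H \<omega>" "0 \<le> G \<omega>" for \<omega>
    using pos by (simp_all add: H_def G_def X_def)
  have f_nonneg: "0 \<le> f\<^sub>H \<theta>\<^sub>1 \<theta>\<^sub>2 x" if "0 < x" for x
    using pos that by (simp add: f\<^sub>H_def)
  \<comment> \<open>\<open>H\<close> is quadratic in \<open>X\<close>, so the first two moments of
    the exponential law give integrability.\<close>
  have int_H: "integrable M H"
    using erlang_ith_moment_integrable[OF _ X, of 1] erlang_ith_moment_integrable[OF _ X, of 2]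
    by (simp add: H_def[abs_def])
  have indep: "indep_var borel H borel G"
    using indep_var_compose[OF assms(4), of "\<lambda>z. \<theta>\<^sub>1 * (cmod z)\<^sup>2 + \<theta>\<^sub>2 * ((cmod z)\<^sup>2)\<^sup>2" borel "\<lambda>z. (cmod z)\<^sup>2" borel]
    by (simp add: comp_def H_def[abs_def] X_def G_def[abs_def])
  have \<epsilon>: "\<epsilon> \<omega> = t\<^sub>e * H \<omega>" for \<omega>
    by (simp add: \<open>\<epsilon> = _\<close> \<open>\<theta>\<^sub>1 = _\<close> \<open>\<theta>\<^sub>2 = _\<close> H_def X_def)
  \<comment> \<open>The deterministic part of the local bits: the cube root splits over the product
    of this nonnegative constant and \<open>H \<omega>\<close>.\<close>
  define C where "C = ((1 - \<tau>) * t\<^sub>e / (\<xi> * \<psi> ^ 3)) powr (1 / 3)"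
  have "l\<^sub>c \<omega> = C * H \<omega> powr (1 / 3)" for \<omega>
  proof -
    have "\<epsilon>\<^sub>c \<omega> / (\<xi> * \<psi> ^ 3) = (1 - \<tau>) * t\<^sub>e / (\<xi> * \<psi> ^ 3) * H \<omega>"
      using \<open>\<epsilon>\<^sub>c = _\<close> by (simp add: \<epsilon>)
    moreover have "0 \<le> (1 - \<tau>) * t\<^sub>e / (\<xi> * \<psi> ^ 3)"
      using \<open>\<tau> \<le> 1\<close> \<open>0 < t\<^sub>e\<close> \<open>\<xi> > 0\<close> \<open>\<psi> > 0\<close> by simp
    ultimately show ?thesis
      using nonneg(1)[of \<omega>] \<open>l\<^sub>c = _\<close> by (simp only: C_def powr_mult)
  qed
  then have l\<^sub>c: "l\<^sub>c = (\<lambda>\<omega>. C * H \<omega> powr (1 / 3))" ..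
  note powr_H = integrable_powr[OF H f_nonneg nonneg(1) int_H, of "1 / 3"]
    set_integrable_powr_density[OF H f_nonneg nonneg(1) int_H, of "1 / 3"]
    expectation_powr[OF H f_nonneg nonneg(1) int_H, of "1 / 3"]
  show ?thesis
  \<comment> \<open>At \<open>\<tau> = 0\<close> no bits are offloaded, and the scale
    \<open>k\<close> introduced below would have denominator 0.\<close>
  proof (cases "\<tau> = 0")
    case True
    then have "l\<^sub>o = (\<lambda>\<omega>. 0)"
      using \<open>l\<^sub>o = _\<close> \<open>\<epsilon>\<^sub>o = _\<close> by simp
    then show ?thesis
      unfolding l\<^sub>c C_def[symmetric] using True powr_H by simp
  next
    case False
    then have \<tau>: "0 < \<tau>" using \<open>0 \<le> \<tau>\<close> by simp
    \<comment> \<open>This scale turns the signal-to-noise ratio into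
      \<open>H \<omega> * G \<omega> / k\<close> and the argument of \<open>E\<^sub>1\<close> into
      \<open>k / x\<close>.\<close>
    define k where "k = t\<^sub>d * r powr \<alpha> * \<sigma>\<^sup>2 / (\<tau> * t\<^sub>e)"
    have k: "0 < k"
      using \<open>\<sigma>\<^sup>2 > 0\<close> \<open>0 < t\<^sub>e\<close> \<tau> pos by (simp add: k_def)
    have k_div: "t\<^sub>d * r powr \<alpha> * \<sigma>\<^sup>2 / (\<tau> * t\<^sub>e * x) = k / x" for x
      by (simp add: k_def)
    have "l\<^sub>o \<omega> = t\<^sub>d * B / ln 2 * ln (1 + H \<omega> * G \<omega> / k)" for \<omega>
    proof -
      have "\<epsilon>\<^sub>o \<omega> / t\<^sub>d * ((cmod (g \<omega>))\<^sup>2 / (r powr \<alpha> * \<sigma>\<^sup>2)) = H \<omega> * G \<omega> / k"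
        using \<open>\<epsilon>\<^sub>o = _\<close> by (simp add: \<epsilon> k_def G_def mult_ac)
      then show ?thesis
        using \<open>l\<^sub>o = _\<close> by (simp add: log_def)
    qed
    then have l\<^sub>o: "l\<^sub>o = (\<lambda>\<omega>. t\<^sub>d * B / ln 2 * ln (1 + H \<omega> * G \<omega> / k))" ..
    note ln_HG = integrable_ln_exponential_product[OF H G indep f_nonneg nonneg int_H k]
      set_integrable_exp_E\<^sub>1[OF H G indep f_nonneg nonneg int_H k]
      expectation_ln_exponential_product[OF H G indep f_nonneg nonneg int_H k]
    show ?thesis
      unfolding k_div l\<^sub>o l\<^sub>c C_def[symmetric]
      using False powr_H ln_HG by simp
  qed
qed

end
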